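(* Let $\Theta$ be any realiser for Cousin's lemma. Then: (1) $\Phi_{\mathsf{reg}}+\Theta+\exists^2$ computes $\Omega_b$; (2) $\Phi_{\mathsf{usco}}+\Theta+\exists^2$ computes $\Omega_C$; (3) $\Phi_{\mathbf\Delta}+\Theta+\exists^2$ computes $\Omega_{\mathbf\Delta}$. Here for a class $\Gamma$ of functions, $\Phi_\Gamma$ denotes any functional such that for every $f:\mathbb R\to\mathbb R$ in $\Gamma$ and every $k\in\mathbb N$, $\Phi_\Gamma(f,k)$ is a $2^{-k}$-gauge for $f$.
   Context: Computability means Kleene's higher-order computability via S1–S9. Kleene's quantifier $\exists^2:\mathbb N^{\mathbb N}\to\{0,1\}$ satisfies $\exists^2(f)=0\iff(\exists n)(f(n)=0)$. Subsets of $\mathbb R$ are given by characteristic functions. $O\subseteq\mathbb R$ is open if every $x\in O$ has some $k$ with $B(x,2^{-k})\subseteq O$; closed sets are complements of open sets; $\mathbf\Delta$ is the class of sets which are both a countable union of closed sets and a countable intersection of open sets. For $\varepsilon>0$, an $\varepsilon$-gauge for $f:\mathbb R\to\mathbb R$ is a function $\delta:\mathbb R\to\mathbb R^+$ such that for all $x,y$, $|x-y|<\min(\delta(x),\delta(y))$ implies $|f(x)-f(y)|<\varepsilon$. A realiser for Cousin's lemma is a functional $\Theta$ such that for every $\Psi:[0,1]\to\mathbb R^+$, $\Theta(\Psi)=(x_0,\dots,x_k)$ is a finite sequence of reals with $[0,1]\subseteq\bigcup_{i\le k}B(x_i,\Psi(x_i))$. The class $\mathsf{reg}$ consists of regulated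 functions (left and right limits exist at every point), $\mathsf{usco}$ of upper semi-continuous functions, and $\mathbf\Delta$ (as a class of functions) of ambivalent functions $f$, i.e.\ those for which $\{x:f(x)<a\}$ and $\{x:f(x)>a\}$ are in $\mathbf\Delta$ for all real $a$. For a class $\Gamma$ of sets, $\Omega_\Gamma$ is the partial functional returning, on $X\in\Gamma$, $1$ if $X\ne\emptyset$ and $0$ if $X=\emptyset$; $\Omega_b$ is this for $\Gamma$ the finite subsets of $\mathbb R$, $\Omega_C$ for the closed subsets, and $\Omega_{\mathbf\Delta}$ for $\mathbf\Delta$. *)

theory Defs
  imports "HOL-Analysis.Analysis" "HOL-Library.Nat_Bijection"
begin

section \<open>Kleene's schemes S1--S9 for arguments of pure type at most 3\<close>

text \<open>
  The pure types are tp(0) = N and tp(n+1) = tp(n) \<rightarrow> N.  Objects of types 0, 1, 2 are total.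
  Objects of type 3 may be partial functionals with total arguments of type 2; the total ones
  are those that never return None.
\<close>

type_synonym tp1 = "nat \<Rightarrow> nat"
type_synonym tp2 = "tp1 \<Rightarrow> nat"
type_synonym tp3 = "tp2 \<Rightarrow> nat option"

definition signature :: "nat list \<Rightarrow> tp1 list \<Rightarrow> tp2 list \<Rightarrow> tp3 list \<Rightarrow> nat" where
  "signature as fs Fs Ps = list_encode [length as, length fs, length Fs, length Ps]"

definition to_front :: "nat \<Rightarrow> 'a list \<Rightarrow> 'a list" where
  "to_front k xs = (xs ! k) # take k xs @ drop (Suc k) xs"

text \<open>
  \<open>kleene e as fs Fs Ps v\<close> says that {e}(as, fs, Fs, Ps) is defined with value v, where
  as, fs, Fs, Ps are the lists of arguments of types 0, 1, 2, 3 (only the order of the arguments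
  within each type matters).  Indices are Goedel numbers [scheme, signature, parameters]
  under the explicit coding \<open>list_encode\<close>; an index applies only to arguments of its signature.
\<close>

inductive kleene :: "nat \<Rightarrow> nat list \<Rightarrow> tp1 list \<Rightarrow> tp2 list \<Rightarrow> tp3 list \<Rightarrow> nat \<Rightarrow> bool" where
  S1: "kleene (list_encode [1, signature (a # as) fs Fs Ps]) (a # as) fs Fs Ps (Suc a)"
| S2: "kleene (list_encode [2, signature as fs Fs Ps, q]) as fs Fs Ps q"
| S3: "kleene (list_encode [3, signature (a # as) fs Fs Ps]) (a # as) fs Fs Ps a"
| S4: "kleene (list_encode [4, signature as fs Fs Ps, g, h]) as fs Fs Ps v"
    if "kleene h as fs Fs Ps u" and "kleene g (u # as) fs Fs Ps v"
| S5_0: "kleene (list_encode [5, signature (0 # as) fs Fs Ps, g, h]) (0 # as) fs Fs Ps v"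
    if "kleene g as fs Fs Ps v"
| S5_Suc: "kleene (list_encode [5, signature (Suc a # as) fs Fs Ps, g, h]) (Suc a # as) fs Fs Ps v"
    if "kleene (list_encode [5, signature (a # as) fs Fs Ps, g, h]) (a # as) fs Fs Ps u"
      and "kleene h (a # u # as) fs Fs Ps v"
| S6_0: "kleene (list_encode [6, signature as fs Fs Ps, 0, k, d]) as fs Fs Ps v"
    if "k < length as" and "kleene d (to_front k as) fs Fs Ps v"
| S6_1: "kleene (list_encode [6, signature as fs Fs Ps, 1, k, d]) as fs Fs Ps v"
    if "k < length fs" and "kleene d as (to_front k fs) Fs Ps v"
| S6_2: "kleene (list_encode [6, signature as fs Fs Ps, 2, k, d]) as fs Fs Ps v"
    if "k < length Fs" and "kleene d as fs (to_front k Fs) Ps v"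
| S6_3: "kleene (list_encode [6, signature as fs Fs Ps, 3, k, d]) as fs Fs Ps v"
    if "k < length Ps" and "kleene d as fs Fs (to_front k Ps) v"
| S7: "kleene (list_encode [7, signature (a # as) (f # fs) Fs Ps]) (a # as) (f # fs) Fs Ps (f a)"
| S8_2: "kleene (list_encode [8, signature as fs (F # Fs) Ps, 2, d]) as fs (F # Fs) Ps (F \<beta>)"
    if "\<And>n. kleene d (n # as) fs (F # Fs) Ps (\<beta> n)"
| S8_3: "kleene (list_encode [8, signature as fs Fs (P # Ps), 3, d]) as fs Fs (P # Ps) v"
    if "\<And>\<alpha>. kleene d as (\<alpha> # fs) Fs (P # Ps) (G \<alpha>)" and "P G = Some v"
| S9: "kleene (list_encode [9, signature (a # as @ as') (fs @ fs') (Fs @ Fs') (Ps @ Ps'),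
               signature as fs Fs Ps])
         (a # as @ as') (fs @ fs') (Fs @ Fs') (Ps @ Ps') v"
    if "kleene a as fs Fs Ps v"

lemma kleene_deterministic:
  "kleene e as fs Fs Ps v \<Longrightarrow> kleene e as fs Fs Ps w \<Longrightarrow> v = w"
proof (induction arbitrary: w rule: kleene.induct)
  case (S8_2 d as fs F Fs Ps \<beta>)
  from S8_2.prems obtain \<beta>' where "w = F \<beta>'" "\<And>n. kleene d (n # as) fs (F # Fs) Ps (\<beta>' n)"
    by (cases rule: kleene.cases) (auto simp: list_encode_eq signature_def simp del: list_encode.simps)
  moreover from this S8_2.IH have "\<beta> = \<beta>'" by blast
  ultimately show ?case by simp
next
  case (S8_3 d as fs Fs P Ps G v)
  from S8_3.prems obtain G' where "P G' = Some w" "\<And>\<alpha>. kleene d as (\<alpha> # fs) Fs (P # Ps) (G' \<alpha>)"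
    by (cases rule: kleene.cases) (auto simp: list_encode_eq signature_def simp del: list_encode.simps)
  moreover from this S8_3.IH have "G = G'" by blast
  ultimately show ?case using S8_3.hyps by simp
next
  case S1
  from S1.prems show ?case
    by (cases rule: kleene.cases) (auto simp: list_encode_eq signature_def simp del: list_encode.simps)
next
  case S2
  from S2.prems show ?case
    by (cases rule: kleene.cases) (auto simp: list_encode_eq signature_def simp del: list_encode.simps)
next
  case S3
  from S3.prems show ?case
    by (cases rule: kleene.cases) (auto simp: list_encode_eq signature_def simp del: list_encode.simps)
next
  case S7
  from S7.prems show ?case
    by (cases rule: kleene.cases) (auto simp: list_encode_eq signature_def simp del: list_encode.simps)
next
  case (S4 h as fs Fs Ps u g v)
  from S4.prems have "\<exists>u'. kleene h as fs Fs Ps u' \<and> kleene g (u' # as) fs Fs Ps w"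
    by (cases rule: kleene.cases) (auto simp: list_encode_eq signature_def simp del: list_encode.simps)
  with S4.IH show ?case by blast
next
  case (S5_0 g as fs Fs Ps v h)
  from S5_0.prems have "kleene g as fs Fs Ps w"
    by (cases rule: kleene.cases) (auto simp: list_encode_eq signature_def simp del: list_encode.simps)
  with S5_0.IH show ?case by blast
next
  case (S5_Suc a as fs Fs Ps g h u v)
  from S5_Suc.prems have "\<exists>u'. kleene (list_encode [5, signature (a # as) fs Fs Ps, g, h]) (a # as) fs Fs Ps u' \<and>
      kleene h (a # u' # as) fs Fs Ps w"
    by (cases rule: kleene.cases) (auto simp: list_encode_eq signature_def simp del: list_encode.simps)
  with S5_Suc.IH show ?case by blast
next
  case (S6_0 k as d fs Fs Ps v)
  from S6_0.prems have "kleene d (to_front k as) fs Fs Ps w"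
    by (cases rule: kleene.cases) (auto simp: list_encode_eq signature_def simp del: list_encode.simps)
  with S6_0.IH show ?case by blast
next
  case (S6_1 k fs d as Fs Ps v)
  from S6_1.prems have "kleene d as (to_front k fs) Fs Ps w"
    by (cases rule: kleene.cases) (auto simp: list_encode_eq signature_def simp del: list_encode.simps)
  with S6_1.IH show ?case by blast
next
  case (S6_2 k Fs d as fs Ps v)
  from S6_2.prems have "kleene d as fs (to_front k Fs) Ps w"
    by (cases rule: kleene.cases) (auto simp: list_encode_eq signature_def simp del: list_encode.simps)
  with S6_2.IH show ?case by blast
next
  case (S6_3 k Ps d as fs Fs v)
  from S6_3.prems have "kleene d as fs Fs (to_front k Ps) w"
    by (cases rule: kleene.cases) (auto simp: list_encode_eq signature_def simp del: list_encode.simps)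
  with S6_3.IH show ?case by blast
next
  case (S9 a as fs Fs Ps v as' fs' Fs' Ps')
  from S9.prems have "kleene a as fs Fs Ps w"
    by (cases rule: kleene.cases) (auto simp: list_encode_eq signature_def simp del: list_encode.simps)
  with S9.IH show ?case by blast
qed


definition exists2 :: tp2 where
  "exists2 f = (if \<exists>n. f n = 0 then 0 else 1)"


section \<open>Representation of the reals and of functions on them\<close>

definition rat_of_code :: "nat \<Rightarrow> real" where
  "rat_of_code n = (case prod_decode n of (a, b) \<Rightarrow> of_int (int_decode a) / of_nat (Suc b))"

text \<open>\<open>\<alpha>\<close> is a fast-converging Cauchy sequence of (coded) rationals with limit \<open>x\<close>.\<close>

definition is_name :: "tp1 \<Rightarrow> real \<Rightarrow> bool" where
  "is_name \<alpha> x \<longleftrightarrow>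
     (\<forall>n i. \<bar>rat_of_code (\<alpha> n) - rat_of_code (\<alpha> (n + i))\<bar> < 1 / 2 ^ n) \<and>
     (\<lambda>n. rat_of_code (\<alpha> n)) \<longlonglongrightarrow> x"

text \<open>
  \<open>F\<close> represents the function \<open>f\<close> with domain \<open>D\<close>: it maps names of \<open>x \<in> D\<close> to names of \<open>f x\<close>.
  In particular it respects equality of reals.
\<close>

definition is_fun_name :: "real set \<Rightarrow> (tp1 \<Rightarrow> tp1) \<Rightarrow> (real \<Rightarrow> real) \<Rightarrow> bool" where
  "is_fun_name D F f \<longleftrightarrow> (\<forall>\<alpha> x. is_name \<alpha> x \<and> x \<in> D \<longrightarrow> is_name (F \<alpha>) (f x))"

definition is_char_fun :: "tp2 \<Rightarrow> real set \<Rightarrow> bool" where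
  "is_char_fun G X \<longleftrightarrow> (\<forall>\<alpha> x. is_name \<alpha> x \<longrightarrow> G \<alpha> = (if x \<in> X then 1 else 0))"


section \<open>Classes of sets and functions\<close>

definition Delta_set :: "real set \<Rightarrow> bool" where
  "Delta_set X \<longleftrightarrow> fsigma X \<and> gdelta X"

definition regulated :: "(real \<Rightarrow> real) \<Rightarrow> bool" where
  "regulated f \<longleftrightarrow>
     (\<forall>x. (\<exists>l. (f \<longlongrightarrow> l) (at_left x)) \<and> (\<exists>r. (f \<longlongrightarrow> r) (at_right x)))"

definition usco :: "(real \<Rightarrow> real) \<Rightarrow> bool" where
  "usco f \<longleftrightarrow> (\<forall>x. \<forall>\<epsilon>>0. \<forall>\<^sub>F y in at x. f y < f x + \<epsilon>)"

definition ambivalent :: "(real \<Rightarrow> real) \<Rightarrow> bool" where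
  "ambivalent f \<longleftrightarrow> (\<forall>a. Delta_set {x. f x < a} \<and> Delta_set {x. f x > a})"


section \<open>Gauge functionals, Cousin realisers, and the functionals Omega\<close>

definition is_gauge :: "real \<Rightarrow> (real \<Rightarrow> real) \<Rightarrow> (real \<Rightarrow> real) \<Rightarrow> bool" where
  "is_gauge \<epsilon> f \<delta> \<longleftrightarrow>
     (\<forall>x. \<delta> x > 0) \<and> (\<forall>x y. \<bar>x - y\<bar> < min (\<delta> x) (\<delta> y) \<longrightarrow> \<bar>f x - f y\<bar> < \<epsilon>)"

text \<open>
  The functionals act on names and may be undefined (None), or arbitrary, on inputs outside the
  intended domain.
\<close>

definition gauge_functional ::
    "((real \<Rightarrow> real) \<Rightarrow> bool) \<Rightarrow> ((tp1 \<Rightarrow> tp1) \<Rightarrow> nat \<Rightarrow> (tp1 \<Rightarrow> tp1) option) \<Rightarrow> bool" where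
  "gauge_functional \<Gamma> \<Phi> \<longleftrightarrow>
     (\<forall>f F k. \<Gamma> f \<and> is_fun_name UNIV F f \<longrightarrow>
        (\<exists>D \<delta>. \<Phi> F k = Some D \<and> is_fun_name UNIV D \<delta> \<and> is_gauge (1 / 2 ^ k) f \<delta>))"

definition cousin_realiser :: "((tp1 \<Rightarrow> tp1) \<Rightarrow> tp1 list option) \<Rightarrow> bool" where
  "cousin_realiser \<Theta> \<longleftrightarrow>
     (\<forall>\<psi> F. (\<forall>x\<in>{0..1}. \<psi> x > 0) \<and> is_fun_name {0..1} F \<psi> \<longrightarrow>
        (\<exists>\<alpha>s xs. \<Theta> F = Some \<alpha>s \<and> list_all2 is_name \<alpha>s xs \<and> set xs \<subseteq> {0..1} \<and>
           {0..1} \<subseteq> (\<Union>x\<in>set xs. ball x (\<psi> x))))"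

definition Omega :: "(real set \<Rightarrow> bool) \<Rightarrow> real set \<Rightarrow> nat option" where
  "Omega \<Gamma> X = (if \<Gamma> X then Some (if X \<noteq> {} then 1 else 0) else None)"


section \<open>Coding by pure types\<close>

text \<open>
  An \<open>F\<close> of type 1 \<rightarrow> 1 is identified with the type-2 object mapping n, \<alpha>(0), \<alpha>(1), ... to
  \<open>F \<alpha> n\<close>, and a pair consisting of such an \<open>F\<close> and a \<open>\<beta>\<close> of type 1 is coded by one type-2
  object \<open>G\<close> from which the two components are read off as follows (\<open>case_nat n \<alpha>\<close> is the
  sequence \<alpha> with n put in front).
\<close>

definition fun_part :: "tp2 \<Rightarrow> tp1 \<Rightarrow> tp1" where
  "fun_part G = (\<lambda>\<alpha> n. G (case_nat 0 (case_nat n \<alpha>)))"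

definition seq_part :: "tp2 \<Rightarrow> tp1" where
  "seq_part G = (\<lambda>n. G (case_nat 1 (case_nat n (\<lambda>_. 0))))"

text \<open>
  \<open>\<Phi>\<close> becomes the type-3 functional (F, k, n, \<alpha>) \<mapsto> \<Phi>(F, k)(\<alpha>)(n), where k, n, \<alpha> are
  put together into the sequence k, n, \<alpha>(0), \<alpha>(1), ...
\<close>

definition gauge3 :: "((tp1 \<Rightarrow> tp1) \<Rightarrow> nat \<Rightarrow> (tp1 \<Rightarrow> tp1) option) \<Rightarrow> tp3" where
  "gauge3 \<Phi> G = (let \<beta> = seq_part G in
     map_option (\<lambda>D. D (\<lambda>i. \<beta> (Suc (Suc i))) (\<beta> 1)) (\<Phi> (fun_part G) (\<beta> 0)))"

text \<open>
  \<open>\<Theta>\<close> becomes the type-3 functional (F, i, n) \<mapsto> entry n of row i, where row 0 has the length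
  of \<open>\<Theta>(F)\<close> in all places and row j + 1 is the j-th member of \<open>\<Theta>(F)\<close>.
\<close>

definition list_entry :: "tp1 list \<Rightarrow> nat \<Rightarrow> tp1" where
  "list_entry \<alpha>s i n =
     (case i of 0 \<Rightarrow> length \<alpha>s | Suc j \<Rightarrow> if j < length \<alpha>s then (\<alpha>s ! j) n else 0)"

definition cousin3 :: "((tp1 \<Rightarrow> tp1) \<Rightarrow> tp1 list option) \<Rightarrow> tp3" where
  "cousin3 \<Theta> G = (let \<beta> = seq_part G in
     map_option (\<lambda>\<alpha>s. list_entry \<alpha>s (\<beta> 0) (\<beta> 1)) (\<Theta> (fun_part G)))"


section \<open>Relative computability\<close>

text \<open>
  A partial functional on sets of reals is computable in given functionals of types 2 and 3 if a
  single index yields its value, from the characteristic function, on every set in its domain.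
\<close>

definition computes :: "tp2 list \<Rightarrow> tp3 list \<Rightarrow> (real set \<Rightarrow> nat option) \<Rightarrow> bool" where
  "computes Fs Ps \<Omega> \<longleftrightarrow>
     (\<exists>e. \<forall>X v G. \<Omega> X = Some v \<and> is_char_fun G X \<longrightarrow> kleene e [] [] (G # Fs) Ps v)"

end

theory Submission
  imports Defs
begin

text \<open>
  Let \<open>\<delta>\<close> be a 1-gauge for the indicator function of \<open>X\<close>, so that
  \<open>\<bar>x - y\<bar> < min (\<delta> x) (\<delta> y)\<close> implies \<open>x \<in> X \<longleftrightarrow> y \<in> X\<close>.  For an integer \<open>m\<close> apply the Cousin
  realiser to \<open>\<psi> y = min (\<delta> (y + m)) (1 / (n + 1))\<close>.  If \<open>x \<in> X\<close> lies in \<open>[m, m + 1]\<close> and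
  \<open>1 / (n + 1) < \<delta> x\<close>, then some member \<open>y\<close> of the resulting list is within \<open>min (\<delta> (y + m)) (\<delta> x)\<close>
  of \<open>x - m\<close>, whence \<open>y + m \<in> X\<close>.  So \<open>X\<close> is nonempty iff it contains one of the countably many points
  obtained in this way from all \<open>m\<close> and \<open>n\<close>, which \<open>\<exists>\<^sup>2\<close> decides.
\<close>

section \<open>Closure properties of Kleene computability\<close>

locale oracles =
  fixes \<G> :: "tp2 set" and P Q :: tp3
begin

text \<open>One index has to serve every \<open>G\<close> in \<open>\<G>\<close>, later the set of
  characteristic functions of members of the class. The restriction matters because \<open>P\<close>
  and \<open>Q\<close>, the coded gauge functional and Cousin realiser, may be undefined on queries
  built from other \<open>G\<close>.\<close>

definition computable :: "nat \<Rightarrow> nat \<Rightarrow> (tp2 \<Rightarrow> nat list \<Rightarrow> tp1 list \<Rightarrow> nat) \<Rightarrow> bool" where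
  "computable p q \<phi> \<longleftrightarrow>
     (\<exists>e. \<forall>G as fs. G \<in> \<G> \<and> length as = p \<and> length fs = q \<longrightarrow>
        kleene e as fs [G, exists2] [P, Q] (\<phi> G as fs))"

lemma computableI:
  assumes "\<And>G as fs. G \<in> \<G> \<Longrightarrow> length as = p \<Longrightarrow> length fs = q \<Longrightarrow>
      kleene e as fs [G, exists2] [P, Q] (\<phi> G as fs)"
  shows "computable p q \<phi>"
  using assms unfolding computable_def by blast

lemma computableE:
  assumes "computable p q \<phi>"
  obtains e where "\<And>G as fs. G \<in> \<G> \<Longrightarrow> length as = p \<Longrightarrow> length fs = q \<Longrightarrow>
      kleene e as fs [G, exists2] [P, Q] (\<phi> G as fs)"
  using assms unfolding computable_def by blast

text \<open>An index contains its signature and is fixed before the arguments are, so the signature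
  is given through lengths. The entries 2 count \<open>G\<close>, \<open>exists2\<close> and
  \<open>P\<close>, \<open>Q\<close>.\<close>

definition sig :: "nat \<Rightarrow> nat \<Rightarrow> nat" where
  "sig p q = list_encode [p, q, 2, 2]"

lemma sig_eq:
  assumes "length as = p" "length fs = q"
  shows "signature as fs [F, F'] [R, R'] = sig p q"
  using assms by (simp add: signature_def sig_def numeral_2_eq_2)

lemma computable_const: "computable p q (\<lambda>G as fs. c)"
  by (rule computableI[where e = "list_encode [2, sig p q, c]"])
     (metis S2 sig_eq)

lemma computable_hd: "computable (Suc p) q (\<lambda>G as fs. hd as)"
proof (rule computableI[where e = "list_encode [3, sig (Suc p) q]"])
  fix G :: tp2 and as :: "nat list" and fs :: "tp1 list"
  assume *: "length as = Suc p" "length fs = q"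
  then obtain a bs where "as = a # bs" by (cases as) auto
  with * S3[of a bs fs "[G, exists2]" "[P, Q]"]
  show "kleene (list_encode [3, sig (Suc p) q]) as fs [G, exists2] [P, Q] (hd as)"
    by (simp add: sig_eq del: list_encode.simps)
qed

lemma computable_Suc_hd: "computable (Suc p) q (\<lambda>G as fs. Suc (hd as))"
proof (rule computableI[where e = "list_encode [1, sig (Suc p) q]"])
  fix G :: tp2 and as :: "nat list" and fs :: "tp1 list"
  assume *: "length as = Suc p" "length fs = q"
  then obtain a bs where "as = a # bs" by (cases as) auto
  with * S1[of a bs fs "[G, exists2]" "[P, Q]"]
  show "kleene (list_encode [1, sig (Suc p) q]) as fs [G, exists2] [P, Q] (Suc (hd as))"
    by (simp add: sig_eq del: list_encode.simps)
qed

text \<open>S4 puts the inner value in front of the arguments. Together with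
  \<open>computable_tl\<close> this provides substitution into any rule about the first
  argument.\<close>

lemma computable_let:
  assumes "computable p q \<phi>" "computable (Suc p) q \<psi>"
  shows "computable p q (\<lambda>G as fs. \<psi> G (\<phi> G as fs # as) fs)"
proof -
  obtain h where h: "\<And>G as fs. G \<in> \<G> \<Longrightarrow> length as = p \<Longrightarrow> length fs = q \<Longrightarrow>
      kleene h as fs [G, exists2] [P, Q] (\<phi> G as fs)"
    using computableE[OF assms(1)] by blast
  obtain g where g: "\<And>G as fs. G \<in> \<G> \<Longrightarrow> length as = Suc p \<Longrightarrow> length fs = q \<Longrightarrow>
      kleene g as fs [G, exists2] [P, Q] (\<psi> G as fs)"
    using computableE[OF assms(2)] by blast
  show ?thesis
  proof (rule computableI[where e = "list_encode [4, sig p q, g, h]"])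
    fix G :: tp2 and as :: "nat list" and fs :: "tp1 list"
    assume *: "G \<in> \<G>" "length as = p" "length fs = q"
    have "kleene g (\<phi> G as fs # as) fs [G, exists2] [P, Q] (\<psi> G (\<phi> G as fs # as) fs)"
      using * by (intro g) auto
    from S4[OF h[OF *] this]
    show "kleene (list_encode [4, sig p q, g, h]) as fs [G, exists2] [P, Q] (\<psi> G (\<phi> G as fs # as) fs)"
      using * by (simp add: sig_eq del: list_encode.simps)
  qed
qed

text \<open>S5 recurses on the first argument; substituting \<open>\<nu>\<close> for it afterwards
  allows any computable recursion length. Counter and previous value reach the step function as the
  first two list entries.\<close>

lemma computable_rec:
  assumes "computable p q \<beta>" "computable p q \<nu>"
    and "computable (Suc (Suc p)) q (\<lambda>G as fs. \<sigma> G (tl (tl as)) fs (hd as) (hd (tl as)))"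
  shows "computable p q (\<lambda>G as fs. rec_nat (\<beta> G as fs) (\<lambda>a u. \<sigma> G as fs a u) (\<nu> G as fs))"
proof -
  obtain g where g: "\<And>G as fs. G \<in> \<G> \<Longrightarrow> length as = p \<Longrightarrow> length fs = q \<Longrightarrow>
      kleene g as fs [G, exists2] [P, Q] (\<beta> G as fs)"
    using computableE[OF assms(1)] by blast
  obtain h where h: "\<And>G as fs. G \<in> \<G> \<Longrightarrow> length as = Suc (Suc p) \<Longrightarrow> length fs = q \<Longrightarrow>
      kleene h as fs [G, exists2] [P, Q] (\<sigma> G (tl (tl as)) fs (hd as) (hd (tl as)))"
    using computableE[OF assms(3)] by blast
  have "computable (Suc p) q (\<lambda>G as fs. rec_nat (\<beta> G (tl as) fs) (\<sigma> G (tl as) fs) (hd as))"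
  proof (rule computableI[where e = "list_encode [5, sig (Suc p) q, g, h]"])
    fix G :: tp2 and as :: "nat list" and fs :: "tp1 list"
    assume *: "G \<in> \<G>" "length as = Suc p" "length fs = q"
    obtain n bs where as: "as = n # bs" and bs: "length bs = p"
      using *(2) by (cases as) auto
    have "kleene (list_encode [5, sig (Suc p) q, g, h]) (n # bs) fs [G, exists2] [P, Q]
        (rec_nat (\<beta> G bs fs) (\<sigma> G bs fs) n)"
    proof (induction n)
      case 0
      from S5_0[OF g[OF *(1) bs *(3)]] show ?case
        using bs *(3) by (simp add: sig_eq del: list_encode.simps)
    next
      case (Suc n)
      have s: "signature (a # bs) fs [G, exists2] [P, Q] = sig (Suc p) q" for a
        using bs *(3) by (simp add: sig_eq)
      have "kleene h (n # rec_nat (\<beta> G bs fs) (\<sigma> G bs fs) n # bs) fs [G, exists2] [P, Q]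
          (\<sigma> G bs fs n (rec_nat (\<beta> G bs fs) (\<sigma> G bs fs) n))"
        using h[of G "n # rec_nat (\<beta> G bs fs) (\<sigma> G bs fs) n # bs" fs] * bs by simp
      from S5_Suc[OF _ this, of g] Suc.IH show ?case
        by (simp add: s del: list_encode.simps)
    qed
    then show "kleene (list_encode [5, sig (Suc p) q, g, h]) as fs [G, exists2] [P, Q]
        (rec_nat (\<beta> G (tl as) fs) (\<sigma> G (tl as) fs) (hd as))"
      by (simp add: as del: list_encode.simps)
  qed
  from computable_let[OF assms(2) this] show ?thesis by simp
qed

section \<open>Permuting and dropping numerical arguments\<close>

text \<open>On a list of length \<open>Suc p\<close>, \<open>to_front p\<close> moves the last entry
  to the front, so its iterates rotate the list.\<close>

lemma to_front_rotate:
  assumes "length (xs @ ys) = Suc p"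
  shows "(to_front p ^^ length ys) (xs @ ys) = ys @ xs"
  using assms
proof (induction ys arbitrary: xs rule: rev_induct)
  case (snoc y ys)
  then have "to_front p (xs @ ys @ [y]) = (y # xs) @ ys"
    by (auto simp: to_front_def nth_append)
  with snoc.IH[of "y # xs"] snoc.prems show ?case
    by (simp add: funpow_Suc_right del: funpow.simps)
qed simp

lemma length_to_front: "k < length xs \<Longrightarrow> length (to_front k xs) = length xs"
  by (simp add: to_front_def)

lemma computable_to_front:
  assumes "computable (Suc p) q \<phi>"
  shows "computable (Suc p) q (\<lambda>G as fs. \<phi> G ((to_front p ^^ n) as) fs)"
proof (induction n)
  case 0
  show ?case using assms by simp
next
  case (Suc n)
  then obtain d where d: "\<And>G as fs. G \<in> \<G> \<Longrightarrow> length as = Suc p \<Longrightarrow> length fs = q \<Longrightarrow>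
      kleene d as fs [G, exists2] [P, Q] (\<phi> G ((to_front p ^^ n) as) fs)"
    using computableE by blast
  show ?case
  proof (rule computableI[where e = "list_encode [6, sig (Suc p) q, 0, p, d]"])
    fix G :: tp2 and as :: "nat list" and fs :: "tp1 list"
    assume *: "G \<in> \<G>" "length as = Suc p" "length fs = q"
    have "kleene d (to_front p as) fs [G, exists2] [P, Q] (\<phi> G ((to_front p ^^ n) (to_front p as)) fs)"
      using * by (intro d) (auto simp: length_to_front)
    from S6_0[OF _ this]
    show "kleene (list_encode [6, sig (Suc p) q, 0, p, d]) as fs [G, exists2] [P, Q]
        (\<phi> G ((to_front p ^^ Suc n) as) fs)"
      using * by (simp add: sig_eq funpow_Suc_right del: list_encode.simps funpow.simps)
  qed
qed

text \<open>S9 hands on only an initial segment of the arguments, which drops the last one. It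
  expects the index as an argument, so S2 produces \<open>d\<close> and S4 puts it in front; hence
  \<open>Suc (Suc p)\<close> in the signature.\<close>

lemma computable_butlast:
  assumes "computable p q \<phi>"
  shows "computable (Suc p) q (\<lambda>G as fs. \<phi> G (butlast as) fs)"
proof -
  obtain d where d: "\<And>G as fs. G \<in> \<G> \<Longrightarrow> length as = p \<Longrightarrow> length fs = q \<Longrightarrow>
      kleene d as fs [G, exists2] [P, Q] (\<phi> G as fs)"
    using computableE[OF assms] by blast
  let ?e = "list_encode [9, sig (Suc (Suc p)) q, sig p q]"
  show ?thesis
  proof (rule computableI[where e = "list_encode [4, sig (Suc p) q, ?e, list_encode [2, sig (Suc p) q, d]]"])
    fix G :: tp2 and as :: "nat list" and fs :: "tp1 list"
    assume *: "G \<in> \<G>" "length as = Suc p" "length fs = q"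
    obtain bs u where as: "as = bs @ [u]" and bs: "length bs = p"
      using *(2) by (cases as rule: rev_cases) auto
    have 2: "kleene (list_encode [2, sig (Suc p) q, d]) as fs [G, exists2] [P, Q] d"
      using S2[of as fs "[G, exists2]" "[P, Q]" d] * by (simp add: sig_eq del: list_encode.simps)
    have "kleene ?e (d # as) fs [G, exists2] [P, Q] (\<phi> G bs fs)"
      using S9[OF d[OF *(1) bs *(3)], of "[u]" "[]" "[]" "[]"] * bs
      by (simp add: sig_eq as del: list_encode.simps)
    from S4[OF 2 this]
    show "kleene (list_encode [4, sig (Suc p) q, ?e, list_encode [2, sig (Suc p) q, d]]) as fs
        [G, exists2] [P, Q] (\<phi> G (butlast as) fs)"
      using * by (simp add: sig_eq as del: list_encode.simps)
  qed
qed

lemma computable_cong: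
  assumes "computable p q \<phi>"
    and "\<And>G as fs. G \<in> \<G> \<Longrightarrow> length as = p \<Longrightarrow> length fs = q \<Longrightarrow> \<phi> G as fs = \<psi> G as fs"
  shows "computable p q \<psi>"
  using assms unfolding computable_def by metis

text \<open>The first argument is rotated to the end, where S9 drops it.\<close>

lemma computable_tl:
  assumes "computable p q \<phi>"
  shows "computable (Suc p) q (\<lambda>G as fs. \<phi> G (tl as) fs)"
proof (rule computable_cong[OF computable_to_front[OF computable_butlast[OF assms], of p]])
  fix G :: tp2 and as :: "nat list" and fs :: "tp1 list"
  assume "length as = Suc p"
  then obtain u bs where as: "as = u # bs" "length bs = p" by (cases as) auto
  have "(to_front p ^^ length bs) ([u] @ bs) = bs @ [u]"
    using as by (intro to_front_rotate) simp
  then show "\<phi> G (butlast ((to_front p ^^ p) as)) fs = \<phi> G (tl as) fs"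
    using as by simp
qed

lemma computable_Suc:
  assumes "computable p q \<phi>"
  shows "computable p q (\<lambda>G as fs. Suc (\<phi> G as fs))"
  using computable_let[OF assms computable_Suc_hd] by simp

lemma computable_fun_hd:
  assumes "computable p (Suc q) \<phi>"
  shows "computable p (Suc q) (\<lambda>G as fs. hd fs (\<phi> G as fs))"
proof -
  have "computable (Suc p) (Suc q) (\<lambda>G as fs. hd fs (hd as))"
  proof (rule computableI[where e = "list_encode [7, sig (Suc p) (Suc q)]"])
    fix G :: tp2 and as :: "nat list" and fs :: "tp1 list"
    assume *: "length as = Suc p" "length fs = Suc q"
    then obtain a bs f gs where "as = a # bs" "fs = f # gs" by (cases as; cases fs) auto
    with * S7[of a bs f gs "[G, exists2]" "[P, Q]"]
    show "kleene (list_encode [7, sig (Suc p) (Suc q)]) as fs [G, exists2] [P, Q] (hd fs (hd as))"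
      by (simp add: sig_eq del: list_encode.simps)
  qed
  from computable_let[OF assms this] show ?thesis by simp
qed

text \<open>Cousin queries contain gauge queries, so two bound sequences can be in force at once,
  the outer one standing second. S7 reads only the first, so S6 exchanges them.\<close>

lemma computable_fun_hd_tl:
  assumes "computable p (Suc (Suc q)) \<phi>"
  shows "computable p (Suc (Suc q)) (\<lambda>G as fs. hd (tl fs) (\<phi> G as fs))"
proof -
  let ?e = "list_encode [7, sig (Suc p) (Suc (Suc q))]"
  have "computable (Suc p) (Suc (Suc q)) (\<lambda>G as fs. hd (tl fs) (hd as))"
  proof (rule computableI[where e = "list_encode [6, sig (Suc p) (Suc (Suc q)), 1, 1, ?e]"])
    fix G :: tp2 and as :: "nat list" and fs :: "tp1 list"
    assume *: "length as = Suc p" "length fs = Suc (Suc q)"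
    then obtain a bs f g hs where as: "as = a # bs" and fs: "fs = f # g # hs"
      by (cases as; cases fs; cases "tl fs") auto
    have "kleene ?e as (to_front 1 fs) [G, exists2] [P, Q] (g a)"
      using * S7[of a bs g "f # hs" "[G, exists2]" "[P, Q]"]
      by (simp add: as fs to_front_def sig_eq del: list_encode.simps)
    from S6_1[OF _ this] *
    show "kleene (list_encode [6, sig (Suc p) (Suc (Suc q)), 1, 1, ?e]) as fs [G, exists2] [P, Q]
        (hd (tl fs) (hd as))"
      by (simp add: as fs sig_eq del: list_encode.simps)
  qed
  from computable_let[OF assms this] show ?thesis by simp
qed

text \<open>
  An argument bound by a functional is put in front of the arguments of its type, hence \<open>hd\<close> and \<open>tl\<close>.
  This form makes the rules below applicable by higher-order pattern unification.
\<close>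

lemma computable_G:
  assumes "computable (Suc p) q (\<lambda>G as fs. \<phi> G (tl as) fs (hd as))"
  shows "computable p q (\<lambda>G as fs. G (\<lambda>n. \<phi> G as fs n))"
proof -
  obtain d where d: "\<And>G as fs. G \<in> \<G> \<Longrightarrow> length as = Suc p \<Longrightarrow> length fs = q \<Longrightarrow>
      kleene d as fs [G, exists2] [P, Q] (\<phi> G (tl as) fs (hd as))"
    using computableE[OF assms] by blast
  show ?thesis
  proof (rule computableI[where e = "list_encode [8, sig p q, 2, d]"])
    fix G :: tp2 and as :: "nat list" and fs :: "tp1 list"
    assume *: "G \<in> \<G>" "length as = p" "length fs = q"
    have "kleene d (n # as) fs [G, exists2] [P, Q] (\<phi> G as fs n)" for n
      using d[of G "n # as" fs] * by simp
    from S8_2[where \<beta> = "\<phi> G as fs", OF this] *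
    show "kleene (list_encode [8, sig p q, 2, d]) as fs [G, exists2] [P, Q] (G (\<phi> G as fs))"
      by (simp add: sig_eq del: list_encode.simps)
  qed
qed

lemma computable_exists2:
  assumes "computable (Suc p) q (\<lambda>G as fs. \<phi> G (tl as) fs (hd as))"
  shows "computable p q (\<lambda>G as fs. exists2 (\<lambda>n. \<phi> G as fs n))"
proof -
  obtain d where d: "\<And>G as fs. G \<in> \<G> \<Longrightarrow> length as = Suc p \<Longrightarrow> length fs = q \<Longrightarrow>
      kleene d as fs [G, exists2] [P, Q] (\<phi> G (tl as) fs (hd as))"
    using computableE[OF assms] by blast
  \<comment> \<open>S8 applies the first functional, so \<open>?e\<close> runs with
    \<open>exists2\<close> in front. Since \<open>d\<close> expects \<open>G\<close> first,
    \<open>?d\<close> swaps them back inside the bound argument.\<close>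
  let ?d = "list_encode [6, sig (Suc p) q, 2, 1, d]"
  let ?e = "list_encode [8, sig p q, 2, ?d]"
  show ?thesis
  proof (rule computableI[where e = "list_encode [6, sig p q, 2, 1, ?e]"])
    fix G :: tp2 and as :: "nat list" and fs :: "tp1 list"
    assume *: "G \<in> \<G>" "length as = p" "length fs = q"
    have "kleene ?d (n # as) fs [exists2, G] [P, Q] (\<phi> G as fs n)" for n
    proof -
      have "kleene d (n # as) fs (to_front 1 [exists2, G]) [P, Q] (\<phi> G as fs n)"
        using d[of G "n # as" fs] * by (simp add: to_front_def)
      from S6_2[OF _ this] * show ?thesis by (simp add: sig_eq del: list_encode.simps)
    qed
    from S8_2[where \<beta> = "\<phi> G as fs", OF this]
    have "kleene ?e as fs (to_front 1 [G, exists2]) [P, Q] (exists2 (\<phi> G as fs))"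
      using * by (simp add: sig_eq to_front_def del: list_encode.simps)
    from S6_2[OF _ this] *
    show "kleene (list_encode [6, sig p q, 2, 1, ?e]) as fs [G, exists2] [P, Q]
        (exists2 (\<phi> G as fs))"
      by (simp add: sig_eq del: list_encode.simps)
  qed
qed

text \<open>S8 demands that the partial functional be defined at the query; the second assumption
  supplies this.\<close>

lemma computable_P:
  assumes "computable p (Suc q) (\<lambda>G as fs. \<phi> G as (tl fs) (hd fs))"
    and "\<And>G as fs. G \<in> \<G> \<Longrightarrow> P (\<lambda>\<alpha>. \<phi> G as fs \<alpha>) \<noteq> None"
  shows "computable p q (\<lambda>G as fs. the (P (\<lambda>\<alpha>. \<phi> G as fs \<alpha>)))"
proof -
  obtain d where d: "\<And>G as fs. G \<in> \<G> \<Longrightarrow> length as = p \<Longrightarrow> length fs = Suc q \<Longrightarrow>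
      kleene d as fs [G, exists2] [P, Q] (\<phi> G as (tl fs) (hd fs))"
    using computableE[OF assms(1)] by blast
  show ?thesis
  proof (rule computableI[where e = "list_encode [8, sig p q, 3, d]"])
    fix G :: tp2 and as :: "nat list" and fs :: "tp1 list"
    assume *: "G \<in> \<G>" "length as = p" "length fs = q"
    have "kleene d as (\<alpha> # fs) [G, exists2] [P, Q] (\<phi> G as fs \<alpha>)" for \<alpha>
      using d[of G as "\<alpha> # fs"] * by simp
    moreover have "P (\<phi> G as fs) = Some (the (P (\<phi> G as fs)))"
      using assms(2)[OF *(1), of as fs] by auto
    ultimately have "kleene (list_encode [8, signature as fs [G, exists2] [P, Q], 3, d]) as fs
        [G, exists2] [P, Q] (the (P (\<phi> G as fs)))"
      by (rule S8_3[where G = "\<phi> G as fs"])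
    with * show "kleene (list_encode [8, sig p q, 3, d]) as fs [G, exists2] [P, Q]
        (the (P (\<phi> G as fs)))"
      by (simp add: sig_eq del: list_encode.simps)
  qed
qed

lemma computable_Q:
  assumes "computable p (Suc q) (\<lambda>G as fs. \<phi> G as (tl fs) (hd fs))"
    and "\<And>G as fs. G \<in> \<G> \<Longrightarrow> Q (\<lambda>\<alpha>. \<phi> G as fs \<alpha>) \<noteq> None"
  shows "computable p q (\<lambda>G as fs. the (Q (\<lambda>\<alpha>. \<phi> G as fs \<alpha>)))"
proof -
  obtain d where d: "\<And>G as fs. G \<in> \<G> \<Longrightarrow> length as = p \<Longrightarrow> length fs = Suc q \<Longrightarrow>
      kleene d as fs [G, exists2] [P, Q] (\<phi> G as (tl fs) (hd fs))"
    using computableE[OF assms(1)] by blast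
  let ?d = "list_encode [6, sig p (Suc q), 3, 1, d]"
  let ?e = "list_encode [8, sig p q, 3, ?d]"
  show ?thesis
  proof (rule computableI[where e = "list_encode [6, sig p q, 3, 1, ?e]"])
    fix G :: tp2 and as :: "nat list" and fs :: "tp1 list"
    assume *: "G \<in> \<G>" "length as = p" "length fs = q"
    have "kleene ?d as (\<alpha> # fs) [G, exists2] [Q, P] (\<phi> G as fs \<alpha>)" for \<alpha>
    proof -
      have "kleene d as (\<alpha> # fs) [G, exists2] (to_front 1 [Q, P]) (\<phi> G as fs \<alpha>)"
        using d[of G as "\<alpha> # fs"] * by (simp add: to_front_def)
      from S6_3[OF _ this] * show ?thesis by (simp add: sig_eq del: list_encode.simps)
    qed
    moreover have "Q (\<phi> G as fs) = Some (the (Q (\<phi> G as fs)))"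
      using assms(2)[OF *(1), of as fs] by auto
    ultimately have "kleene (list_encode [8, signature as fs [G, exists2] [Q, P], 3, ?d]) as fs
        [G, exists2] [Q, P] (the (Q (\<phi> G as fs)))"
      by (rule S8_3[where G = "\<phi> G as fs"])
    then have "kleene ?e as fs [G, exists2] (to_front 1 [P, Q]) (the (Q (\<phi> G as fs)))"
      using * by (simp add: sig_eq to_front_def del: list_encode.simps)
    from S6_3[OF _ this] *
    show "kleene (list_encode [6, sig p q, 3, 1, ?e]) as fs [G, exists2] [P, Q]
        (the (Q (\<phi> G as fs)))"
      by (simp add: sig_eq del: list_encode.simps)
  qed
qed

end

section \<open>Arithmetic of coded rationals\<close>

text \<open>The largest k with \<open>triangle k\<close> at most n. Primitive recursion suffices,
  since the root grows by at most one when n does.\<close>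

definition triangle_root :: "nat \<Rightarrow> nat" where
  "triangle_root n = rec_nat 0 (\<lambda>a u. if triangle (Suc u) \<le> Suc a then Suc u else u) n"

lemma triangle_root_bounds: "triangle (triangle_root n) \<le> n \<and> n < triangle (Suc (triangle_root n))"
proof (induction n)
  case (Suc n)
  then show ?case
    by (auto simp: triangle_root_def)
qed (simp add: triangle_root_def)

text \<open>\<open>prod_encode (a, b)\<close> is \<open>triangle (a + b) + a\<close>, so the
  triangular root recovers a + b and the remainder is a.\<close>

lemma prod_decode_triangle_root:
  "prod_decode n = (n - triangle (triangle_root n), triangle_root n - (n - triangle (triangle_root n)))"
proof -
  define k where "k = triangle_root n"
  have k: "triangle k \<le> n" "n < triangle (Suc k)"
    using triangle_root_bounds[of n] by (auto simp: k_def)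
  then have "n - triangle k \<le> k" by simp
  then have "prod_encode (n - triangle k, k - (n - triangle k)) = n"
    using k by (simp add: prod_encode_def)
  then show ?thesis unfolding k_def[symmetric] by (metis prod_encode_inverse)
qed

lemma int_decode_eq_diff:
  "int_decode a = (if a mod 2 = 0 then int (a div 2) else - int (Suc (a div 2)))"
  by (auto simp: int_decode_def sum_decode_def even_iff_mod_2_eq_zero split: sum.splits)

text \<open>The numerator is kept as a difference of naturals s and t, which avoids signed
  arithmetic. Even codes stand for nonnegative and odd codes for negative integers, hence
  \<open>2 * (t - s) - 1\<close>. Conditions are tests for 0, as in
  \<open>computable_if\<close>.\<close>

definition shift_code :: "nat \<Rightarrow> nat \<Rightarrow> nat \<Rightarrow> nat" where
  "shift_code u w c =
     (let a = fst (prod_decode c); b = snd (prod_decode c);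
          s = (if a mod 2 = 0 then a div 2 else 0) + u * Suc b;
          t = (if a mod 2 = 0 then 0 else Suc (a div 2)) + w * Suc b
      in prod_encode (if t - s = 0 then 2 * (s - t) else 2 * (t - s) - 1, b))"

lemma rat_of_shift_code: "rat_of_code (shift_code u w c) = rat_of_code c + (real u - real w)"
proof -
  obtain a b where ab: "prod_decode c = (a, b)" by force
  define s where "s = (if a mod 2 = 0 then a div 2 else 0) + u * Suc b"
  define t where "t = (if a mod 2 = 0 then 0 else Suc (a div 2)) + w * Suc b"
  define e where "e = (if t - s = 0 then 2 * (s - t) else 2 * (t - s) - 1)"
  have "shift_code u w c = prod_encode (e, b)"
    unfolding shift_code_def ab fst_conv snd_conv Let_def e_def s_def t_def ..
  then have "rat_of_code (shift_code u w c) = real_of_int (int_decode e) / real (Suc b)"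
    by (simp add: rat_of_code_def)
  also have "int_decode e = int s - int t"
    unfolding e_def int_decode_eq_diff by (auto simp: of_nat_diff; presburger)
  also have "\<dots> = int_decode a + (int u - int w) * int (Suc b)"
    unfolding int_decode_eq_diff s_def t_def by (simp add: algebra_simps)
  also have "real_of_int (int_decode a + (int u - int w) * int (Suc b)) / real (Suc b) =
      rat_of_code c + (real u - real w)"
    by (simp add: rat_of_code_def ab add_divide_distrib del: of_nat_Suc)
  finally show ?thesis .
qed

text \<open>\<open>prod_encode (2, n)\<close> codes 1/(n+1), as 2 codes the integer 1. For an even
  numerator code the truncated difference vanishes iff the rational is at most 1/(n+1); a negative
  rational is below the cap anyway.\<close>

definition cap_code :: "nat \<Rightarrow> nat \<Rightarrow> nat" where
  "cap_code n c =
     (if fst (prod_decode c) mod 2 = 0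
      then if fst (prod_decode c) div 2 * Suc n - Suc (snd (prod_decode c)) = 0 then c
        else prod_encode (2, n)
      else c)"

lemma rat_of_cap_code: "rat_of_code (cap_code n c) = min (rat_of_code c) (1 / real (Suc n))"
proof -
  obtain a b where ab: "prod_decode c = (a, b)" by force
  have "int_decode 2 = 1" by (simp add: int_decode_eq_diff)
  then have 1: "rat_of_code (prod_encode (2, n)) = 1 / real (Suc n)"
    by (simp add: rat_of_code_def)
  have "rat_of_code c \<le> 1 / real (Suc n) \<longleftrightarrow> real_of_int (int_decode a) * real (Suc n) \<le> real (Suc b)"
    by (simp add: rat_of_code_def ab field_simps)
  also have "\<dots> \<longleftrightarrow> int_decode a * int (Suc n) \<le> int (Suc b)"
    using of_int_le_iff[where 'a = real, of "int_decode a * int (Suc n)" "int (Suc b)"]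
    by (simp only: of_int_mult of_int_of_nat_eq)
  also have "\<dots> \<longleftrightarrow> a mod 2 \<noteq> 0 \<or> a div 2 * Suc n \<le> Suc b"
  proof (cases "a mod 2 = 0")
    case True
    then have "int_decode a * int (Suc n) = int (a div 2 * Suc n)"
      by (simp add: int_decode_eq_diff distrib_left)
    then show ?thesis using True by (simp only: of_nat_le_iff) simp
  next
    case False
    have "int_decode a * int (Suc n) \<le> 0"
      using False by (simp add: int_decode_eq_diff mult_le_0_iff)
    then show ?thesis using False by simp
  qed
  finally show ?thesis
    using 1 by (auto simp: cap_code_def ab min_def)
qed

section \<open>Primitive recursive arithmetic on codes\<close>

context oracles
begin

lemma computable_hd_tl: "computable (Suc (Suc p)) q (\<lambda>G as fs. hd (tl as))"
  by (rule computable_tl[OF computable_hd])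

lemma computable_if:
  assumes "computable p q \<phi>" "computable p q \<psi>" "computable p q \<rho>"
  shows "computable p q (\<lambda>G as fs. if \<phi> G as fs = 0 then \<psi> G as fs else \<rho> G as fs)"
proof (rule computable_cong)
  show "computable p q (\<lambda>G as fs. rec_nat (\<psi> G as fs) (\<lambda>a u. \<rho> G as fs) (\<phi> G as fs))"
    by (intro computable_rec assms computable_tl[of "Suc p"] computable_tl[of p])
  show "rec_nat (\<psi> G as fs) (\<lambda>a u. \<rho> G as fs) (\<phi> G as fs) =
      (if \<phi> G as fs = 0 then \<psi> G as fs else \<rho> G as fs)" for G as fs
    by (cases "\<phi> G as fs") auto
qed

lemma computable_add:
  assumes "computable p q \<phi>" "computable p q \<psi>"
  shows "computable p q (\<lambda>G as fs. \<phi> G as fs + \<psi> G as fs)"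
proof (rule computable_cong)
  show "computable p q (\<lambda>G as fs. rec_nat (\<phi> G as fs) (\<lambda>a u. Suc u) (\<psi> G as fs))"
    by (intro computable_rec assms computable_Suc computable_hd_tl)
  have "rec_nat x (\<lambda>a u. Suc u) y = x + y" for x y :: nat
    by (induction y) auto
  then show "rec_nat (\<phi> G as fs) (\<lambda>a u. Suc u) (\<psi> G as fs) = \<phi> G as fs + \<psi> G as fs" for G as fs .
qed

lemma computable_pred:
  assumes "computable p q \<phi>"
  shows "computable p q (\<lambda>G as fs. \<phi> G as fs - 1)"
proof (rule computable_cong)
  show "computable p q (\<lambda>G as fs. rec_nat 0 (\<lambda>a u. a) (\<phi> G as fs))"
    by (intro computable_rec assms computable_const computable_hd)
  show "rec_nat 0 (\<lambda>a u. a) (\<phi> G as fs) = \<phi> G as fs - 1" for G as fs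
    by (cases "\<phi> G as fs") auto
qed

lemma computable_diff:
  assumes "computable p q \<phi>" "computable p q \<psi>"
  shows "computable p q (\<lambda>G as fs. \<phi> G as fs - \<psi> G as fs)"
proof (rule computable_cong)
  show "computable p q (\<lambda>G as fs. rec_nat (\<phi> G as fs) (\<lambda>a u. u - 1) (\<psi> G as fs))"
    by (intro computable_rec assms computable_pred computable_hd_tl)
  have "rec_nat x (\<lambda>a u. u - 1) y = x - y" for x y :: nat
    by (induction y) auto
  then show "rec_nat (\<phi> G as fs) (\<lambda>a u. u - 1) (\<psi> G as fs) = \<phi> G as fs - \<psi> G as fs" for G as fs .
qed

lemma computable_mult:
  assumes "computable p q \<phi>" "computable p q \<psi>"
  shows "computable p q (\<lambda>G as fs. \<phi> G as fs * \<psi> G as fs)"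
proof (rule computable_cong)
  show "computable p q (\<lambda>G as fs. rec_nat 0 (\<lambda>a u. u + \<psi> G as fs) (\<phi> G as fs))"
    by (intro computable_rec assms computable_const computable_add computable_hd_tl
        computable_tl[of "Suc p"] computable_tl[of p])
  have "rec_nat 0 (\<lambda>a u. u + y) x = x * y" for x y :: nat
    by (induction x) auto
  then show "rec_nat 0 (\<lambda>a u. u + \<psi> G as fs) (\<phi> G as fs) = \<phi> G as fs * \<psi> G as fs" for G as fs .
qed

lemma computable_mod2:
  assumes "computable p q \<phi>"
  shows "computable p q (\<lambda>G as fs. \<phi> G as fs mod 2)"
proof (rule computable_cong)
  show "computable p q (\<lambda>G as fs. rec_nat 0 (\<lambda>a u. 1 - u) (\<phi> G as fs))"
    by (intro computable_rec assms computable_const computable_diff computable_hd_tl)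
  have "rec_nat 0 (\<lambda>a u. 1 - u) x = x mod 2" for x :: nat
    by (induction x) (auto simp: mod_Suc)
  then show "rec_nat 0 (\<lambda>a u. 1 - u) (\<phi> G as fs) = \<phi> G as fs mod 2" for G as fs .
qed

lemma computable_div2:
  assumes "computable p q \<phi>"
  shows "computable p q (\<lambda>G as fs. \<phi> G as fs div 2)"
proof (rule computable_cong)
  show "computable p q (\<lambda>G as fs. rec_nat 0 (\<lambda>a u. u + a mod 2) (\<phi> G as fs))"
    by (intro computable_rec assms computable_const computable_add computable_mod2
        computable_hd computable_hd_tl)
  have "rec_nat 0 (\<lambda>a u. u + a mod 2) x = x div 2" for x :: nat
    by (induction x) (auto, presburger)
  then show "rec_nat 0 (\<lambda>a u. u + a mod 2) (\<phi> G as fs) = \<phi> G as fs div 2" for G as fs .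
qed

lemma computable_triangle:
  assumes "computable p q \<phi>"
  shows "computable p q (\<lambda>G as fs. triangle (\<phi> G as fs))"
  unfolding triangle_def
  by (intro computable_div2 computable_mult computable_Suc assms)

lemma computable_triangle_root:
  assumes "computable p q \<phi>"
  shows "computable p q (\<lambda>G as fs. triangle_root (\<phi> G as fs))"
proof (rule computable_cong)
  show "computable p q (\<lambda>G as fs. rec_nat 0
      (\<lambda>a u. if triangle (Suc u) - Suc a = 0 then Suc u else u) (\<phi> G as fs))"
    by (intro computable_rec assms computable_const computable_if computable_diff computable_triangle
        computable_Suc computable_hd computable_hd_tl)
qed (simp add: triangle_root_def)

lemma computable_fst_prod_decode:
  assumes "computable p q \<phi>"
  shows "computable p q (\<lambda>G as fs. fst (prod_decode (\<phi> G as fs)))"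
  unfolding prod_decode_triangle_root fst_conv
  by (intro computable_diff computable_triangle computable_triangle_root assms)

lemma computable_snd_prod_decode:
  assumes "computable p q \<phi>"
  shows "computable p q (\<lambda>G as fs. snd (prod_decode (\<phi> G as fs)))"
  unfolding prod_decode_triangle_root snd_conv
  by (intro computable_diff computable_triangle computable_triangle_root assms)

lemma computable_prod_encode:
  assumes "computable p q \<phi>" "computable p q \<psi>"
  shows "computable p q (\<lambda>G as fs. prod_encode (\<phi> G as fs, \<psi> G as fs))"
  unfolding prod_encode_def prod.case
  by (intro computable_add computable_triangle assms)

lemma computable_shift_code:
  assumes "computable p q \<phi>" "computable p q \<psi>" "computable p q \<rho>"
  shows "computable p q (\<lambda>G as fs. shift_code (\<phi> G as fs) (\<psi> G as fs) (\<rho> G as fs))"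
  unfolding shift_code_def Let_def
  by (intro computable_prod_encode computable_if computable_add computable_diff computable_mult
      computable_Suc computable_const computable_mod2 computable_div2
      computable_fst_prod_decode computable_snd_prod_decode assms)

lemma computable_cap_code:
  assumes "computable p q \<phi>" "computable p q \<psi>"
  shows "computable p q (\<lambda>G as fs. cap_code (\<phi> G as fs) (\<psi> G as fs))"
  unfolding cap_code_def
  by (intro computable_prod_encode computable_if computable_diff computable_mult
      computable_Suc computable_const computable_mod2 computable_div2
      computable_fst_prod_decode computable_snd_prod_decode assms)

end

section \<open>The search for an element\<close>

lemma is_name_const: "is_name (\<lambda>_. c) (rat_of_code c)"
  by (simp add: is_name_def)

lemma is_name_shift_code:
  assumes "is_name \<alpha> x"
  shows "is_name (\<lambda>n. shift_code u w (\<alpha> n)) (x + (real u - real w))"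
  using assms unfolding is_name_def rat_of_shift_code by (auto intro: tendsto_add)

lemma is_name_cap_code:
  assumes "is_name \<alpha> x"
  shows "is_name (\<lambda>k. cap_code n (\<alpha> k)) (min x (1 / real (Suc n)))"
proof -
  \<comment> \<open>Truncation at a constant is 1-Lipschitz, so applying it termwise keeps the
    convergence rate required of a name.\<close>
  have *: "\<bar>min a c - min b c\<bar> \<le> \<bar>a - b\<bar>" for a b c :: real
    by linarith
  show ?thesis
    using assms unfolding is_name_def rat_of_cap_code
    by (intro conjI allI le_less_trans[OF *] tendsto_min tendsto_const) auto
qed

lemma list_entry_Suc: "j < length \<alpha>s \<Longrightarrow> list_entry \<alpha>s (Suc j) = \<alpha>s ! j"
  by (simp add: list_entry_def fun_eq_iff)

lemma is_name_list_entry: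
  assumes "list_all2 is_name \<alpha>s xs"
  shows "\<exists>x. is_name (list_entry \<alpha>s i) x"
proof (cases "\<exists>j<length \<alpha>s. i = Suc j")
  case True
  then show ?thesis
    using assms by (metis list_entry_Suc list_all2_nthD)
next
  case False
  then have "list_entry \<alpha>s i = (\<lambda>_. if i = 0 then length \<alpha>s else 0)"
    by (auto simp: list_entry_def fun_eq_iff split: nat.split)
  then show ?thesis using is_name_const by metis
qed

text \<open>A joint right inverse of \<open>fun_part\<close> and \<open>seq_part\<close>: the first
  entry of the argument selects the component.\<close>

definition pair_code :: "(tp1 \<Rightarrow> tp1) \<Rightarrow> tp1 \<Rightarrow> tp2" where
  "pair_code F \<beta> = (\<lambda>\<gamma>. if \<gamma> 0 = 0 then F (\<lambda>i. \<gamma> (Suc (Suc i))) (\<gamma> (Suc 0)) else \<beta> (\<gamma> (Suc 0)))"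

lemma fun_part_pair_code [simp]: "fun_part (pair_code F \<beta>) = F"
  by (simp add: fun_part_def pair_code_def)

lemma seq_part_pair_code [simp]: "seq_part (pair_code F \<beta>) = \<beta>"
  by (simp add: seq_part_def pair_code_def)

text \<open>The numbers 0 and 5 code the rationals 0 and 1.\<close>

definition indicator_name :: "tp2 \<Rightarrow> tp1 \<Rightarrow> tp1" where
  "indicator_name G = (\<lambda>\<alpha> n. 5 * G \<alpha>)"

lemma is_fun_name_indicator_name:
  assumes "is_char_fun G X"
  shows "is_fun_name UNIV (indicator_name G) (indicator X)"
proof -
  \<comment> \<open>The pair consists of 2, the integer code of 1, and 0, the code of denominator
    1.\<close>
  have "prod_encode (2, 0) = 5"
    by (simp add: prod_encode_def triangle_def)
  then have 5: "prod_decode 5 = (2, 0)"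
    by (metis prod_encode_inverse)
  have "rat_of_code 5 = 1" "rat_of_code 0 = 0"
    using prod_encode_inverse[of "(0, 0)"]
    by (simp_all add: rat_of_code_def 5 int_decode_eq_diff prod_encode_def)
  then have "rat_of_code (5 * G \<alpha>) = indicator X x" if "is_name \<alpha> x" for \<alpha> x
    using assms that by (auto simp: is_char_fun_def)
  then show ?thesis
    unfolding is_fun_name_def indicator_name_def by (metis is_name_const)
qed

section \<open>Oracle queries and computability of the search\<close>

context oracles
begin

text \<open>The sequence component is 0, r, \<alpha>(0), \<alpha>(1), ... in the order read by
  \<open>gauge3\<close>: precision 0, which asks for a 1-gauge, then the output position, then the
  point.\<close>

definition gauge_query :: "tp2 \<Rightarrow> tp1 \<Rightarrow> nat \<Rightarrow> tp2" where
  "gauge_query G \<alpha> r =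
     pair_code (indicator_name G) (\<lambda>m. if m = 0 then 0 else if m - 1 = 0 then r else \<alpha> (m - 2))"

text \<open>With \<delta> the gauge answered by \<open>P\<close>, this represents
  \<open>min (\<delta> (x + (u - w))) (1 / (n + 1))\<close>. The integer shift is a difference of
  naturals so that \<open>exists2\<close> can search for it.\<close>

definition cousin_fun :: "tp2 \<Rightarrow> nat \<Rightarrow> nat \<Rightarrow> nat \<Rightarrow> tp1 \<Rightarrow> tp1" where
  "cousin_fun G u w n =
     (\<lambda>\<alpha> r. cap_code n (the (P (gauge_query G (\<lambda>i. shift_code u w (\<alpha> i)) r))))"

definition cousin_query :: "tp2 \<Rightarrow> nat \<Rightarrow> nat \<Rightarrow> nat \<Rightarrow> nat \<Rightarrow> nat \<Rightarrow> tp2" where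
  "cousin_query G u w n i j = pair_code (cousin_fun G u w n) (\<lambda>m. if m = 0 then i else j)"

text \<open>A centre in [0, 1] is moved back to the unit interval starting at the integer u -
  w.\<close>

definition cousin_point :: "tp2 \<Rightarrow> nat \<Rightarrow> nat \<Rightarrow> nat \<Rightarrow> nat \<Rightarrow> tp1" where
  "cousin_point G u w n i = (\<lambda>j. shift_code u w (the (Q (cousin_query G u w n i j))))"

text \<open>
  The index \<open>i\<close> needs no bound: row 0 of the coded list and the rows beyond its length are
  constant, hence names of rationals, and so every hit of the search is a genuine element of the set.
\<close>

definition search :: "tp2 \<Rightarrow> nat" where
  "search G = 1 - exists2 (\<lambda>u. exists2 (\<lambda>w. exists2 (\<lambda>n. exists2 (\<lambda>i.
     1 - G (cousin_point G u w n i)))))"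

text \<open>\<open>exists2\<close> returns 0 on success, so nested calls combine without negation,
  and the innermost \<open>1 - G\<close> is 0 exactly at a hit.\<close>

lemma search_eq:
  "search G = (if \<exists>u w n i. G (cousin_point G u w n i) \<noteq> 0 then 1 else 0)"
  by (auto simp: search_def exists2_def Suc_le_eq)

text \<open>Entry 1 of the bound sequence is the position m at which the sequence component of the
  query is read, so \<alpha> is needed only at m - 2.\<close>

lemma computable_gauge:
  assumes P: "\<And>G \<alpha> r. G \<in> \<G> \<Longrightarrow> P (gauge_query G \<alpha> r) \<noteq> None"
    and "computable p (Suc q) (\<lambda>G as fs. \<alpha> G as (tl fs) (hd fs (Suc 0) - 2))"
    and "computable p (Suc q) (\<lambda>G as fs. \<rho> G as (tl fs))"
  shows "computable p q (\<lambda>G as fs. the (P (gauge_query G (\<alpha> G as fs) (\<rho> G as fs))))"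
  unfolding gauge_query_def pair_code_def indicator_name_def
proof (rule computable_P, goal_cases)
  case 1
  show ?case
    by (intro computable_if computable_mult computable_diff computable_G computable_const
        computable_Suc computable_hd computable_fun_hd assms)
next
  case (2 G as fs)
  then show ?case
    using P[of G "\<alpha> G as fs" "\<rho> G as fs"]
    by (simp add: gauge_query_def pair_code_def indicator_name_def)
qed

text \<open>The numerical parameters occur under zero, one or two bound sequences, so they are
  assumed computable for every \<open>q\<close>.\<close>

lemma computable_cousin_point:
  assumes P: "\<And>G \<alpha> r. G \<in> \<G> \<Longrightarrow> P (gauge_query G \<alpha> r) \<noteq> None"
    and Q: "\<And>G u w n i j. G \<in> \<G> \<Longrightarrow> Q (cousin_query G u w n i j) \<noteq> None"
    and "\<And>q. computable p q (\<lambda>G as fs. \<mu> G as)"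
    and "\<And>q. computable p q (\<lambda>G as fs. \<nu> G as)"
    and "\<And>q. computable p q (\<lambda>G as fs. \<kappa> G as)"
    and "\<And>q. computable p q (\<lambda>G as fs. \<iota> G as)"
    and "\<And>q. computable p q (\<lambda>G as fs. \<tau> G as)"
  shows "computable p q (\<lambda>G as fs.
    cousin_point G (\<mu> G as) (\<nu> G as) (\<kappa> G as) (\<iota> G as) (\<tau> G as))"
  unfolding cousin_point_def cousin_query_def cousin_fun_def
    pair_code_def[of "\<lambda>\<alpha> r. cap_code n (f \<alpha> r)" for n f]
proof (intro computable_shift_code computable_Q assms, goal_cases)
  case 1
  show ?case
    by (intro computable_if computable_cap_code computable_gauge computable_shift_code computable_Suc
        computable_diff computable_const computable_fun_hd computable_fun_hd_tl assms)
next
  case (2 G as fs)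
  then show ?case
    using Q[of G "\<mu> G as" "\<nu> G as" "\<kappa> G as" "\<iota> G as" "\<tau> G as"]
    by (simp add: cousin_query_def cousin_fun_def pair_code_def)
qed

lemma computable_search:
  assumes P: "\<And>G \<alpha> r. G \<in> \<G> \<Longrightarrow> P (gauge_query G \<alpha> r) \<noteq> None"
    and Q: "\<And>G u w n i j. G \<in> \<G> \<Longrightarrow> Q (cousin_query G u w n i j) \<noteq> None"
  shows "computable 0 0 (\<lambda>G as fs. search G)"
  unfolding search_def
  \<comment> \<open>Under all binders the numerical arguments are the position, i, n, w, u in this
    order; the iterated \<open>computable_tl\<close> rules select the last three.\<close>
  by (intro computable_diff computable_exists2 computable_const computable_G
      computable_cousin_point[OF P Q] computable_hd computable_hd_tl
      computable_tl[OF computable_hd_tl] computable_tl[OF computable_tl[OF computable_hd_tl]]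
      computable_tl[OF computable_tl[OF computable_tl[OF computable_hd_tl]]])

end

section \<open>Correctness of the search\<close>

text \<open>The gauge functional is only queried about indicators of members of
  \<open>\<Gamma>\<close>, so all three claims reduce to indicators lying in the function
  class.\<close>

lemma computes_Omega:
  assumes \<Theta>: "cousin_realiser \<Theta>" and \<Phi>: "gauge_functional \<Delta> \<Phi>"
    and \<Gamma>: "\<And>X. \<Gamma> X \<Longrightarrow> \<Delta> (indicator X)"
  shows "computes [exists2] [gauge3 \<Phi>, cousin3 \<Theta>] (Omega \<Gamma>)"
proof -
  interpret oracles "{G. \<exists>X. \<Gamma> X \<and> is_char_fun G X}" "gauge3 \<Phi>" "cousin3 \<Theta>" .
  \<comment> \<open>All gauge queries for \<open>G\<close> present the same function and precision
    to \<open>\<Phi>\<close>, so one \<delta> answers them all.\<close>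
  have gauge: "\<exists>D \<delta>. is_fun_name UNIV D \<delta> \<and> is_gauge 1 (indicator X) \<delta> \<and>
      (\<forall>\<alpha> r. gauge3 \<Phi> (gauge_query G \<alpha> r) = Some (D \<alpha> r))"
    if X: "\<Gamma> X" "is_char_fun G X" for G X
  proof -
    obtain D \<delta> where "\<Phi> (indicator_name G) 0 = Some D" "is_fun_name UNIV D \<delta>"
      "is_gauge 1 (indicator X) \<delta>"
      using \<Phi> \<Gamma>[OF X(1)] is_fun_name_indicator_name[OF X(2)]
      unfolding gauge_functional_def by (metis div_by_1 power_0)
    then show ?thesis
      by (auto simp: gauge3_def gauge_query_def)
  qed
  have cousin: "\<exists>\<alpha>s xs. list_all2 is_name \<alpha>s xs \<and>
      {0..1} \<subseteq> (\<Union>x\<in>set xs. ball x (min (\<delta> (x + (real u - real w))) (1 / real (Suc n)))) \<and>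
      (\<forall>i j. cousin3 \<Theta> (cousin_query G u w n i j) = Some (list_entry \<alpha>s i j))"
    if D: "is_fun_name UNIV D \<delta>" "is_gauge 1 (indicator X :: real \<Rightarrow> real) \<delta>"
      "\<And>\<alpha> r. gauge3 \<Phi> (gauge_query G \<alpha> r) = Some (D \<alpha> r)" for G X D \<delta> u w n
  proof -
    let ?\<psi> = "\<lambda>x. min (\<delta> (x + (real u - real w))) (1 / real (Suc n))"
    have "cousin_fun G u w n = (\<lambda>\<alpha> r. cap_code n (D (\<lambda>i. shift_code u w (\<alpha> i)) r))"
      by (simp add: cousin_fun_def D(3))
    then have "is_fun_name {0..1} (cousin_fun G u w n) ?\<psi>"
      using D(1) unfolding is_fun_name_def by (auto simp del: of_nat_Suc intro!: is_name_cap_code is_name_shift_code)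
    moreover have "\<forall>x\<in>{0..1}. ?\<psi> x > 0"
      using D(2) by (simp add: is_gauge_def)
    ultimately obtain \<alpha>s xs where "\<Theta> (cousin_fun G u w n) = Some \<alpha>s" "list_all2 is_name \<alpha>s xs"
      "{0..1} \<subseteq> (\<Union>x\<in>set xs. ball x (?\<psi> x))"
      using \<Theta>[unfolded cousin_realiser_def, THEN spec, THEN spec, of ?\<psi> "cousin_fun G u w n"]
      by blast
    then show ?thesis
      by (intro exI[of _ \<alpha>s] exI[of _ xs]) (simp add: cousin3_def cousin_query_def)
  qed
  have "computable 0 0 (\<lambda>G as fs. search G)"
  proof (rule computable_search)
    fix G u w n i j \<alpha> r
    assume "G \<in> {G. \<exists>X. \<Gamma> X \<and> is_char_fun G X}"
    then obtain X where X: "\<Gamma> X" "is_char_fun G X" by blast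
    obtain D \<delta> where D: "is_fun_name UNIV D \<delta>" "is_gauge 1 (indicator X :: real \<Rightarrow> real) \<delta>"
      "\<And>\<alpha> r. gauge3 \<Phi> (gauge_query G \<alpha> r) = Some (D \<alpha> r)"
      using gauge[OF X] by blast
    show "gauge3 \<Phi> (gauge_query G \<alpha> r) \<noteq> None"
      by (simp add: D(3))
    show "cousin3 \<Theta> (cousin_query G u w n i j) \<noteq> None"
      using cousin[OF D, of u w n] by auto
  qed
  then obtain e where e: "\<And>X G. \<Gamma> X \<Longrightarrow> is_char_fun G X \<Longrightarrow>
      kleene e [] [] [G, exists2] [gauge3 \<Phi>, cousin3 \<Theta>] (search G)"
    unfolding computable_def by auto
  have search: "search G = (if X \<noteq> {} then 1 else 0)" if X: "\<Gamma> X" "is_char_fun G X" for X G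
  proof -
    obtain D \<delta> where D: "is_fun_name UNIV D \<delta>" "is_gauge 1 (indicator X :: real \<Rightarrow> real) \<delta>"
      "\<And>\<alpha> r. gauge3 \<Phi> (gauge_query G \<alpha> r) = Some (D \<alpha> r)"
      using gauge[OF X] by blast
    \<comment> \<open>Soundness: every row names some real, so a nonzero value of \<open>G\<close>
      exhibits an element.\<close>
    have "X \<noteq> {}" if "G (cousin_point G u w n i) \<noteq> 0" for u w n i
    proof -
      obtain \<alpha>s xs where xs: "list_all2 is_name \<alpha>s xs"
        "\<And>j. cousin3 \<Theta> (cousin_query G u w n i j) = Some (list_entry \<alpha>s i j)"
        using cousin[OF D] by metis
      obtain x where "is_name (list_entry \<alpha>s i) x"
        using is_name_list_entry[OF xs(1)] by blast
      then have "is_name (cousin_point G u w n i) (x + (real u - real w))"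
        unfolding cousin_point_def xs(2) option.sel by (rule is_name_shift_code)
      with X(2) that show ?thesis
        unfolding is_char_fun_def by (metis empty_iff)
    qed
    moreover have "\<exists>u w n i. G (cousin_point G u w n i) \<noteq> 0" if "x \<in> X" for x
    proof -
      \<comment> \<open>\<open>nat\<close> makes at least one of the two 0; their difference is the
        floor of x, which brings x into [0, 1].\<close>
      define u w where "u = nat \<lfloor>x\<rfloor>" and "w = nat (- \<lfloor>x\<rfloor>)"
      have uw: "real u - real w = of_int \<lfloor>x\<rfloor>"
        by (simp add: u_def w_def)
      \<comment> \<open>The cover controls distances only by the gauge at the centre; the cap
        1/(n+1) brings in the gauge at x as well.\<close>
      obtain n where n: "1 / real (Suc n) < \<delta> x"
        using D(2) unfolding is_gauge_def by (metis nat_approx_posE)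
      obtain \<alpha>s xs where xs: "list_all2 is_name \<alpha>s xs"
        "{0..1} \<subseteq> (\<Union>y\<in>set xs. ball y (min (\<delta> (y + (real u - real w))) (1 / real (Suc n))))"
        "\<And>i j. cousin3 \<Theta> (cousin_query G u w n i j) = Some (list_entry \<alpha>s i j)"
        using cousin[OF D] by metis
      have "x - of_int \<lfloor>x\<rfloor> \<in> {0..1}"
        by (simp, linarith)
      then have "x - of_int \<lfloor>x\<rfloor> \<in>
          (\<Union>y\<in>set xs. ball y (min (\<delta> (y + of_int \<lfloor>x\<rfloor>)) (1 / real (Suc n))))"
        using xs(2) unfolding uw by (rule rev_subsetD)
      then obtain j where j: "j < length xs"
        "x - of_int \<lfloor>x\<rfloor> \<in> ball (xs ! j) (min (\<delta> (xs ! j + of_int \<lfloor>x\<rfloor>)) (1 / real (Suc n)))"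
        by (auto simp only: UN_iff in_set_conv_nth)
      let ?y = "xs ! j + of_int \<lfloor>x\<rfloor>"
      have "\<bar>?y - x\<bar> < min (\<delta> ?y) (\<delta> x)"
        using j(2) n by (auto simp: dist_real_def)
      with D(2) have "\<bar>indicator X ?y - indicator X x :: real\<bar> < 1"
        unfolding is_gauge_def by blast
      with that have "?y \<in> X"
        by (auto simp: indicator_def split: if_splits)
      \<comment> \<open>The index is shifted by one because row 0 holds the length.\<close>
      moreover have "list_entry \<alpha>s (Suc j) = \<alpha>s ! j"
        using j(1) xs(1) by (auto simp: list_entry_Suc dest: list_all2_lengthD)
      then have "is_name (cousin_point G u w n (Suc j)) ?y"
        using xs(1) j(1) is_name_shift_code[of "\<alpha>s ! j" "xs ! j" u w]
        by (simp add: cousin_point_def xs(3) uw list_all2_conv_all_nth)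
      ultimately have "G (cousin_point G u w n (Suc j)) = 1"
        using X(2) unfolding is_char_fun_def by auto
      then show ?thesis by (metis zero_neq_one)
    qed
    ultimately show ?thesis
      unfolding search_eq by (metis all_not_in_conv)
  qed
  have "kleene e [] [] (G # [exists2]) [gauge3 \<Phi>, cousin3 \<Theta>] v"
    if "Omega \<Gamma> X = Some v" "is_char_fun G X" for X v G
    using that e[of X G] search[of X G] by (auto simp: Omega_def split: if_splits)
  then show ?thesis
    unfolding computes_def by blast
qed

section \<open>Indicators in the three function classes\<close>

text \<open>A finite set without x is closed, so the indicator is 0 at all points near x other than
  x. Limits within an arbitrary S cover both sides at once.\<close>

lemma regulated_indicator:
  assumes "finite X"
  shows "regulated (indicator X)"
proof -
  have "(indicator X \<longlongrightarrow> (0::real)) (at x within S)" for x S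
  proof (rule tendsto_eventually)
    have "open (- (X - {x}))"
      using assms by (intro open_Compl finite_imp_closed) auto
    then show "\<forall>\<^sub>F y in at x within S. indicator X y = (0::real)"
      unfolding eventually_at_topological
      by (intro exI[of _ "- (X - {x})"]) (auto simp: indicator_def)
  qed
  then show ?thesis unfolding regulated_def by blast
qed

text \<open>On X the indicator attains its maximum; off X it vanishes on a neighbourhood, the
  complement being open.\<close>

lemma usco_indicator:
  assumes "closed X"
  shows "usco (indicator X)"
  unfolding usco_def
proof (intro allI impI)
  fix x \<epsilon> :: real
  assume "\<epsilon> > 0"
  show "\<forall>\<^sub>F y in at x. indicator X y < indicator X x + \<epsilon>"
  proof (cases "x \<in> X")
    case True
    with \<open>\<epsilon> > 0\<close> show ?thesis by (auto simp: indicator_def intro!: always_eventually)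
  next
    case False
    then have "\<forall>\<^sub>F y in at x. y \<in> - X"
      using assms by (intro eventually_at_in_open') auto
    then show ?thesis
      by eventually_elim (use \<open>\<epsilon> > 0\<close> in \<open>auto simp: indicator_def\<close>)
  qed
qed

lemma Delta_set_Compl: "Delta_set X \<Longrightarrow> Delta_set (- X)"
  unfolding Delta_set_def using fsigma_imp_gdelta gdelta_imp_fsigma by blast

text \<open>Each strict level set is empty, the whole line, X or its complement, and complementation
  exchanges the two halves of \<open>Delta_set\<close>.\<close>

lemma ambivalent_indicator:
  assumes "Delta_set X"
  shows "ambivalent (indicator X)"
proof -
  have "Delta_set {}" "Delta_set UNIV"
    using fsigma.intros[of "\<lambda>_. {}"] gdelta.intros[of "\<lambda>_. {}"] gdelta.intros[of "\<lambda>_. UNIV"]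
    by (auto simp: Delta_set_def)
  moreover have "{x. indicator X x < a} = (if a \<le> 0 then {} else if a \<le> 1 then - X else UNIV)"
    "{x. indicator X x > a} = (if a < 0 then UNIV else if a < 1 then X else {})" for a :: real
    by (auto simp: indicator_def)
  ultimately show ?thesis
    unfolding ambivalent_def using assms Delta_set_Compl by simp
qed

theorem theorem2p9:
  fixes \<Theta> :: "(tp1 \<Rightarrow> tp1) \<Rightarrow> tp1 list option"
  assumes "cousin_realiser \<Theta>"
  shows "(\<forall>\<Phi>. gauge_functional regulated \<Phi> \<longrightarrow>
            computes [exists2] [gauge3 \<Phi>, cousin3 \<Theta>] (Omega finite)) \<and>
         (\<forall>\<Phi>. gauge_functional usco \<Phi> \<longrightarrow>
            computes [exists2] [gauge3 \<Phi>, cousin3 \<Theta>] (Omega closed)) \<and>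
         (\<forall>\<Phi>. gauge_functional ambivalent \<Phi> \<longrightarrow>
            computes [exists2] [gauge3 \<Phi>, cousin3 \<Theta>] (Omega Delta_set))"
  using computes_Omega[OF assms] regulated_indicator usco_indicator ambivalent_indicator by metis

end
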